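(* Let $r\ge 1$ and let $n_1\le n_2\le\dots\le n_r$ be positive integers, $\bar n=(n_1,\dots,n_r)$. Let $$\text{d-}P_{\bar n}=\frac{S_{\min}^{n_1}\times\cdots\times S_{\min}^{n_r}}{(x_1,\dots,x_r)\sim(-x_1,\dots,-x_r)}$$ be the digital projective product space. Then $$\text{d-}TC(\text{d-}P_{\bar n})\le 2\,\text{d-cat}(\text{d-}P_{\bar n})\le 2(n_1+r-1).$$
   Context: Digital images: a digital image is a set $X$ (typically a finite subset of some $\mathbb Z^N$) with an adjacency relation (symmetric, irreflexive). Throughout, a subset of $\mathbb Z^N$ carries the maximal adjacency $c_N$: distinct $x,y$ are adjacent iff $|x_i-y_i|\le 1$ for all $i$. In a Cartesian product of digital images, two distinct points are adjacent iff in each coordinate they are equal or adjacent. In a quotient of a digital image by an equivalence relation, two distinct classes are adjacent iff they have adjacent representatives. Continuity: a subset $U$ is connected if any two of its points are joined by a finite sequence in $U$ of consecutively adjacent points. A map $f:X\to Y$ of digital images is digitally continuous if it sends connected subsets to connected subsets (equivalently, adjacent points go to equal or adjacent points). Let $I_m=\{0,1,\dots,m\}\subset\mathbb Z$ with consecutive integers adjacent. Homotopy: digitally continuous maps $f,g:X\to Y$ are digitally homotopic if for some positive integer $m$ there is $H:X\times I_m\to Y$ with $H(x,0)=f(x)$ and $H(x,m)=g(x)$ for all $x\in X$, such that $t\mapsto H(x,t)$ is digitally continuous on $I_m$ for each $x$, and $x\mapsto H(x,t)$ is digitally continuous on $X$ for each $t$. A map is digitally nullhomotopic if it is digitally homotopic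 to a constant map. Digital LS-category: $\text{d-cat}(X)$ is the least integer $l$ such that $X$ is covered by $l+1$ subsets $U_0,\dots,U_l$ for which each inclusion $U_i\hookrightarrow X$ is digitally nullhomotopic in $X$. Digital topological complexity: $X^{I_m}$ is the set of digitally continuous maps (paths) $\alpha:I_m\to X$; two distinct paths $\alpha,\beta\in X^{I_m}$ are adjacent iff $\alpha(t),\beta(t)$ are equal or adjacent for every $t\in I_m$. Let $\pi:X^{I_m}\to X\times X$, $\pi(\alpha)=(\alpha(0),\alpha(m))$. $\text{d-}TC(X)$ is the least integer $l$ such that $X\times X$ is covered by subsets $U_0,\dots,U_l$ and, for each $i$ and some $m$, there is a digitally continuous map $s_i:U_i\to X^{I_m}$ with $\pi\circ s_i=\mathrm{id}_{U_i}$. Minimal digital sphere: $S_{\min}^n\subset\mathbb Z^{n+1}$ is the set of the $2n+2$ points $\pm e_0,\dots,\pm e_n$, where $e_i$ are the standard basis vectors. Thus any two distinct points are adjacent except antipodal pairs $e_i,-e_i$. *)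

theory Defs
  imports "HOL-Library.FuncSet" "HOL-Library.Extended_Nat"
begin

section \<open>Digital images\<close>

record 'a dimage =
  points :: "'a set"
  adj :: "'a \<Rightarrow> 'a \<Rightarrow> bool"

definition digital_image :: "'a dimage \<Rightarrow> bool" where
  "digital_image X \<longleftrightarrow>
     (\<forall>x\<in>points X. \<not> adj X x x) \<and>
     (\<forall>x\<in>points X. \<forall>y\<in>points X. adj X x y \<longrightarrow> adj X y x)"

definition adj_or_eq :: "'a dimage \<Rightarrow> 'a \<Rightarrow> 'a \<Rightarrow> bool" where
  "adj_or_eq X x y \<longleftrightarrow> x = y \<or> adj X x y"

definition subimage :: "'a dimage \<Rightarrow> 'a set \<Rightarrow> 'a dimage" where
  "subimage X U = \<lparr>points = U, adj = adj X\<rparr>"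

definition image_prod :: "'a dimage \<Rightarrow> 'b dimage \<Rightarrow> ('a \<times> 'b) dimage" where
  "image_prod X Y =
     \<lparr>points = points X \<times> points Y,
      adj = (\<lambda>p q. p \<noteq> q \<and> adj_or_eq X (fst p) (fst q) \<and> adj_or_eq Y (snd p) (snd q))\<rparr>"

definition image_Prod :: "'i set \<Rightarrow> ('i \<Rightarrow> 'a dimage) \<Rightarrow> ('i \<Rightarrow> 'a) dimage" where
  "image_Prod I X =
     \<lparr>points = (\<Pi>\<^sub>E i\<in>I. points (X i)),
      adj = (\<lambda>x y. x \<noteq> y \<and> (\<forall>i\<in>I. adj_or_eq (X i) (x i) (y i)))\<rparr>"

definition image_quotient :: "'a dimage \<Rightarrow> ('a \<times> 'a) set \<Rightarrow> 'a set dimage" where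
  "image_quotient X R =
     \<lparr>points = points X // R,
      adj = (\<lambda>A B. A \<noteq> B \<and> (\<exists>x\<in>A. \<exists>y\<in>B. adj X x y))\<rparr>"


section \<open>Continuity and homotopy\<close>

definition digitally_connected :: "'a dimage \<Rightarrow> 'a set \<Rightarrow> bool" where
  "digitally_connected X U \<longleftrightarrow>
     (\<forall>x\<in>U. \<forall>y\<in>U. (\<lambda>a b. a \<in> U \<and> b \<in> U \<and> adj X a b)\<^sup>*\<^sup>* x y)"

definition digitally_continuous :: "'a dimage \<Rightarrow> 'b dimage \<Rightarrow> ('a \<Rightarrow> 'b) \<Rightarrow> bool" where
  "digitally_continuous X Y f \<longleftrightarrow>
     f \<in> points X \<rightarrow> points Y \<and>
     (\<forall>U. U \<subseteq> points X \<and> digitally_connected X U \<longrightarrow> digitally_connected Y (f ` U))"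

definition interval :: "nat \<Rightarrow> nat dimage" where
  "interval m = \<lparr>points = {0..m}, adj = (\<lambda>s t. t = s + 1 \<or> s = t + 1)\<rparr>"

definition digitally_homotopic ::
    "'a dimage \<Rightarrow> 'b dimage \<Rightarrow> ('a \<Rightarrow> 'b) \<Rightarrow> ('a \<Rightarrow> 'b) \<Rightarrow> bool" where
  "digitally_homotopic X Y f g \<longleftrightarrow>
     digitally_continuous X Y f \<and> digitally_continuous X Y g \<and>
     (\<exists>m>0. \<exists>H :: 'a \<Rightarrow> nat \<Rightarrow> 'b.
        (\<forall>x\<in>points X. H x 0 = f x \<and> H x m = g x) \<and>
        (\<forall>x\<in>points X. digitally_continuous (interval m) Y (\<lambda>t. H x t)) \<and>
        (\<forall>t\<in>points (interval m). digitally_continuous X Y (\<lambda>x. H x t)))"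

definition digitally_nullhomotopic :: "'a dimage \<Rightarrow> 'b dimage \<Rightarrow> ('a \<Rightarrow> 'b) \<Rightarrow> bool" where
  "digitally_nullhomotopic X Y f \<longleftrightarrow>
     (\<exists>c\<in>points Y. digitally_homotopic X Y f (\<lambda>_. c))"


section \<open>LS-category and topological complexity\<close>

text \<open>Both invariants take values in \<^typ>\<open>enat\<close>: they are \<open>\<infinity>\<close> when there is no finite cover
  of the required kind.\<close>

definition d_cat :: "'a dimage \<Rightarrow> enat" where
  "d_cat X = Inf {enat l | l. \<exists>U :: nat \<Rightarrow> 'a set.
     (\<Union>i\<in>{0..l}. U i) = points X \<and>
     (\<forall>i\<in>{0..l}. digitally_nullhomotopic (subimage X (U i)) X (\<lambda>x. x))}"

text \<open>Paths are extensional functions, so that two paths are equal exactly when they agree on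
  the interval.\<close>

definition path_space :: "nat \<Rightarrow> 'a dimage \<Rightarrow> (nat \<Rightarrow> 'a) dimage" where
  "path_space m X =
     \<lparr>points = {\<alpha> \<in> extensional (points (interval m)). digitally_continuous (interval m) X \<alpha>},
      adj = (\<lambda>\<alpha> \<beta>. \<alpha> \<noteq> \<beta> \<and> (\<forall>t\<in>points (interval m). adj_or_eq X (\<alpha> t) (\<beta> t)))\<rparr>"

definition path_ends :: "nat \<Rightarrow> (nat \<Rightarrow> 'a) \<Rightarrow> 'a \<times> 'a" where
  "path_ends m \<alpha> = (\<alpha> 0, \<alpha> m)"

definition d_TC :: "'a dimage \<Rightarrow> enat" where
  "d_TC X = Inf {enat l | l. \<exists>U :: nat \<Rightarrow> ('a \<times> 'a) set.
     (\<Union>i\<in>{0..l}. U i) = points (image_prod X X) \<and>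
     (\<forall>i\<in>{0..l}. \<exists>m. \<exists>s.
        digitally_continuous (subimage (image_prod X X) (U i)) (path_space m X) s \<and>
        (\<forall>p\<in>U i. path_ends m (s p) = p))}"


section \<open>Minimal spheres and projective product spaces\<close>

text \<open>The lattice of rank \<open>N\<close>, with coordinates indexed by \<open>{0..<N}\<close> and maximal adjacency.\<close>

definition lattice :: "nat \<Rightarrow> (nat \<Rightarrow> int) dimage" where
  "lattice N =
     \<lparr>points = {0..<N} \<rightarrow>\<^sub>E UNIV,
      adj = (\<lambda>x y. x \<noteq> y \<and> (\<forall>i\<in>{0..<N}. \<bar>x i - y i\<bar> \<le> 1))\<rparr>"

definition basis_vec :: "nat \<Rightarrow> nat \<Rightarrow> nat \<Rightarrow> int" where
  "basis_vec N i = (\<lambda>j\<in>{0..<N}. if j = i then 1 else 0)"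

definition neg_vec :: "nat \<Rightarrow> (nat \<Rightarrow> int) \<Rightarrow> nat \<Rightarrow> int" where
  "neg_vec N x = (\<lambda>j\<in>{0..<N}. - x j)"

definition S_min :: "nat \<Rightarrow> (nat \<Rightarrow> int) dimage" where
  "S_min n = subimage (lattice (n + 1))
     (\<Union>i\<in>{0..n}. {basis_vec (n + 1) i, neg_vec (n + 1) (basis_vec (n + 1) i)})"

definition sphere_prod :: "nat \<Rightarrow> (nat \<Rightarrow> nat) \<Rightarrow> (nat \<Rightarrow> nat \<Rightarrow> int) dimage" where
  "sphere_prod r n = image_Prod {1..r} (\<lambda>k. S_min (n k))"

definition antipode :: "nat \<Rightarrow> (nat \<Rightarrow> nat) \<Rightarrow> (nat \<Rightarrow> nat \<Rightarrow> int) \<Rightarrow> nat \<Rightarrow> nat \<Rightarrow> int" where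
  "antipode r n x = (\<lambda>k\<in>{1..r}. neg_vec (n k + 1) (x k))"

definition antipodal_rel ::
    "nat \<Rightarrow> (nat \<Rightarrow> nat) \<Rightarrow> ((nat \<Rightarrow> nat \<Rightarrow> int) \<times> (nat \<Rightarrow> nat \<Rightarrow> int)) set" where
  "antipodal_rel r n =
     {(x, y). x \<in> points (sphere_prod r n) \<and> y \<in> points (sphere_prod r n) \<and>
              (y = x \<or> y = antipode r n x)}"

definition d_P :: "nat \<Rightarrow> (nat \<Rightarrow> nat) \<Rightarrow> (nat \<Rightarrow> nat \<Rightarrow> int) set dimage" where
  "d_P r n = image_quotient (sphere_prod r n) (antipodal_rel r n)"


section \<open>Basic facts\<close>

lemma digitally_continuous_iff:
  assumes X: "digital_image X" and Y: "digital_image Y"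
  shows "digitally_continuous X Y f \<longleftrightarrow>
     f \<in> points X \<rightarrow> points Y \<and>
     (\<forall>x\<in>points X. \<forall>y\<in>points X. adj X x y \<longrightarrow> adj_or_eq Y (f x) (f y))"
    (is "?L \<longleftrightarrow> ?R")
proof
  assume L: ?L
  have "adj_or_eq Y (f x) (f y)" if xy: "x \<in> points X" "y \<in> points X" "adj X x y" for x y
  proof -
    let ?r = "\<lambda>a b. a \<in> {x, y} \<and> b \<in> {x, y} \<and> adj X a b"
    have "adj X y x" using X xy by (auto simp: digital_image_def)
    then have "?r\<^sup>*\<^sup>* x y" "?r\<^sup>*\<^sup>* y x" using xy by (auto intro!: r_into_rtranclp)
    then have "digitally_connected X {x, y}" unfolding digitally_connected_def by auto
    moreover have "{x, y} \<subseteq> points X" using xy by simp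
    ultimately have "digitally_connected Y (f ` {x, y})"
      using L unfolding digitally_continuous_def by (elim conjE allE[of _ "{x, y}"]) simp
    then have path: "(\<lambda>a b. a \<in> f ` {x, y} \<and> b \<in> f ` {x, y} \<and> adj Y a b)\<^sup>*\<^sup>* (f x) (f y)"
      unfolding digitally_connected_def by simp
    have "\<not> adj Y (f x) (f x)"
      using Y L xy by (auto simp: digital_image_def digitally_continuous_def)
    with path show ?thesis
      by (cases rule: converse_rtranclpE) (auto simp: adj_or_eq_def)
  qed
  then show ?R using L by (auto simp: digitally_continuous_def)
next
  assume R: ?R
  have "digitally_connected Y (f ` U)"
    if U: "U \<subseteq> points X" "digitally_connected X U" for U
  proof -
    have "(\<lambda>a b. a \<in> f ` U \<and> b \<in> f ` U \<and> adj Y a b)\<^sup>*\<^sup>* (f x) (f y)"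
      if "(\<lambda>a b. a \<in> U \<and> b \<in> U \<and> adj X a b)\<^sup>*\<^sup>* x y" for x y
      using that
    proof (induction rule: rtranclp_induct)
      case (step y z)
      then have "adj_or_eq Y (f y) (f z)" using R U by blast
      then show ?case
        using step by (auto simp: adj_or_eq_def intro: rtranclp.rtrancl_into_rtrancl)
    qed simp
    then show ?thesis using U by (auto simp: digitally_connected_def)
  qed
  then show ?L using R by (auto simp: digitally_continuous_def)
qed

lemma digital_image_S_min: "digital_image (S_min n)"
  by (auto simp: digital_image_def S_min_def subimage_def lattice_def abs_minus_commute)

lemma S_min_points: "points (S_min n) \<subseteq> points (lattice (n + 1))"
  by (auto simp: S_min_def subimage_def lattice_def basis_vec_def neg_vec_def)

lemma neg_vec_S_min:
  assumes "x \<in> points (S_min n)"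
  shows "neg_vec (n + 1) x \<in> points (S_min n)" "neg_vec (n + 1) (neg_vec (n + 1) x) = x"
proof -
  have inv: "neg_vec (n + 1) (neg_vec (n + 1) z) = z" if "z \<in> points (lattice (n + 1))" for z
  proof
    show "neg_vec (n + 1) (neg_vec (n + 1) z) j = z j" for j
      using that by (auto simp: lattice_def neg_vec_def PiE_def extensional_def)
  qed
  show "neg_vec (n + 1) (neg_vec (n + 1) x) = x"
    using inv S_min_points assms by blast
  have "basis_vec (n + 1) i \<in> points (lattice (n + 1))" for i
    by (simp add: lattice_def basis_vec_def)
  then have "neg_vec (n + 1) (neg_vec (n + 1) (basis_vec (n + 1) i)) = basis_vec (n + 1) i" for i
    using inv by blast
  then show "neg_vec (n + 1) x \<in> points (S_min n)"
    using assms unfolding S_min_def subimage_def by auto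
qed

text \<open>Distinct points of a minimal sphere are adjacent unless they are antipodal.\<close>

lemma adj_S_min:
  assumes x: "x \<in> points (S_min n)" and y: "y \<in> points (S_min n)"
  shows "adj (S_min n) x y \<longleftrightarrow> x \<noteq> y \<and> y \<noteq> neg_vec (n + 1) x"
proof -
  let ?v = "\<lambda>c i. \<lambda>j\<in>{0..<n + 1}. if j = i then c else (0::int)"
  have form: "\<exists>i c. i \<le> n \<and> (c = 1 \<or> c = -1) \<and> z = ?v c i" if z: "z \<in> points (S_min n)" for z
  proof -
    obtain i where i: "i \<le> n"
      "z = basis_vec (n + 1) i \<or> z = neg_vec (n + 1) (basis_vec (n + 1) i)"
      using z by (auto simp: S_min_def subimage_def)
    then have "z = ?v 1 i \<or> z = ?v (-1) i"
      by (auto simp: basis_vec_def neg_vec_def fun_eq_iff)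
    then show ?thesis using i by blast
  qed
  obtain i c where 1: "i \<le> n" "c = 1 \<or> c = -1" "x = ?v c i" using form[OF x] by blast
  obtain k d where 2: "k \<le> n" "d = 1 \<or> d = -1" "y = ?v d k" using form[OF y] by blast
  have neg: "neg_vec (n + 1) x = ?v (-c) i"
    using 1 by (auto simp: neg_vec_def fun_eq_iff)
  have adj: "adj (S_min n) x y \<longleftrightarrow> x \<noteq> y \<and> (\<forall>j\<in>{0..<n + 1}. \<bar>x j - y j\<bar> \<le> 1)"
    by (simp add: S_min_def subimage_def lattice_def)
  show ?thesis
  proof (cases "i = k")
    case True
    show ?thesis
    proof (cases "c = d")
      case True
      then have "x = y" by (simp only: 1(3) 2(3) \<open>i = k\<close>)
      then show ?thesis unfolding adj by simp
    next
      case False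
      then have d: "d = - c" using 1 2 by auto
      then have "y = neg_vec (n + 1) x" by (simp only: neg 2(3) \<open>i = k\<close> d)
      moreover have "\<not> \<bar>x i - y i\<bar> \<le> 1" using 1 2 \<open>i = k\<close> d by auto
      moreover have "i \<in> {0..<n + 1}" using 1 by simp
      ultimately show ?thesis unfolding adj by blast
    qed
  next
    case False
    have "y k = d" "x k = 0" "neg_vec (n + 1) x k = 0"
      using 1 2 False neg by simp_all
    moreover have "d \<noteq> 0" using 2(2) by auto
    ultimately have "y \<noteq> neg_vec (n + 1) x" "x \<noteq> y" by metis+
    moreover have "\<bar>x j - y j\<bar> \<le> 1" if "j \<in> {0..<n + 1}" for j
      using that 1(2) 2(2) False unfolding 1(3) 2(3) by auto
    ultimately show ?thesis unfolding adj by blast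
  qed
qed

lemma digital_image_sphere_prod: "digital_image (sphere_prod r n)"
proof -
  have "adj_or_eq (S_min (n k)) b a"
    if "adj_or_eq (S_min (n k)) a b" "a \<in> points (S_min (n k))" "b \<in> points (S_min (n k))"
    for k a b
    using that digital_image_S_min[of "n k"] unfolding digital_image_def adj_or_eq_def by blast
  note sym = this
  show ?thesis
    unfolding digital_image_def sphere_prod_def image_Prod_def dimage.simps PiE_iff
    by (blast intro: sym)
qed

lemma equiv_antipodal_rel: "equiv (points (sphere_prod r n)) (antipodal_rel r n)"
proof -
  have inv: "antipode r n (antipode r n x) = x" if "x \<in> points (sphere_prod r n)" for x
  proof
    show "antipode r n (antipode r n x) k = x k" for k
    proof (cases "k \<in> {1..r}")
      case True
      then have "x k \<in> points (S_min (n k))"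
        using that by (simp add: sphere_prod_def image_Prod_def PiE_iff)
      then show ?thesis using True neg_vec_S_min(2) by (simp add: antipode_def)
    next
      case False
      then show ?thesis
        using that by (auto simp: antipode_def sphere_prod_def image_Prod_def PiE_def extensional_def)
    qed
  qed
  show ?thesis
  proof (rule equivI)
    show "antipodal_rel r n \<subseteq> points (sphere_prod r n) \<times> points (sphere_prod r n)"
      unfolding antipodal_rel_def by blast
    show "refl_on (points (sphere_prod r n)) (antipodal_rel r n)"
      unfolding antipodal_rel_def refl_on_def by blast
    show "sym (antipodal_rel r n)"
      by (rule symI) (auto simp: antipodal_rel_def inv)
    show "trans (antipodal_rel r n)"
      by (rule transI) (auto simp: antipodal_rel_def inv)
  qed
qed

lemma digital_image_d_P: "digital_image (d_P r n)"
proof -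
  let ?S = "sphere_prod r n"
  have sub: "A \<subseteq> points ?S" if "A \<in> points (d_P r n)" for A
    using that in_quotient_imp_subset[OF equiv_antipodal_rel]
    by (simp add: d_P_def image_quotient_def)
  have adj: "adj (d_P r n) A B \<longleftrightarrow> A \<noteq> B \<and> (\<exists>x\<in>A. \<exists>y\<in>B. adj ?S x y)" for A B
    by (simp add: d_P_def image_quotient_def)
  have "adj ?S y x" if "adj ?S x y" "x \<in> points ?S" "y \<in> points ?S" for x y
    using that digital_image_sphere_prod unfolding digital_image_def by blast
  then show ?thesis
    unfolding digital_image_def adj using sub by blast
qed

end

theory Submission
  imports Defs
begin

text \<open>A digital homotopy need only be continuous in each variable separately, so any two continuous
  maps that are pointwise equal or adjacent are homotopic. The classes of tuples of positive basis
  vectors form a clique \<open>Q\<close> in the projective product space, and since all \<open>n k\<close> are at least \<open>1\<close>,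
  every point is adjacent to a point of \<open>Q\<close>: choose in each factor a basis vector other than \<open>\<plusminus>x k\<close>.
  A choice \<open>x \<mapsto> f x \<in> Q\<close> of such points is automatically continuous. Hence \<open>x, f x, c\<close> with
  \<open>c \<in> Q\<close> contracts the space, and \<open>x, f x, f y, y\<close> is a continuous motion planner, so both
  invariants vanish.\<close>

lemma digital_image_subimage:
  "digital_image X \<Longrightarrow> U \<subseteq> points X \<Longrightarrow> digital_image (subimage X U)"
  by (auto simp: digital_image_def subimage_def)

lemma digital_image_interval: "digital_image (interval m)"
  by (auto simp: digital_image_def interval_def)

lemma adj_or_eq_sym:
  "digital_image X \<Longrightarrow> x \<in> points X \<Longrightarrow> y \<in> points X \<Longrightarrow> adj_or_eq X x y \<Longrightarrow> adj_or_eq X y x"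
  by (auto simp: digital_image_def adj_or_eq_def)

lemma digital_image_image_prod:
  assumes "digital_image X" "digital_image Y"
  shows "digital_image (image_prod X Y)"
  using adj_or_eq_sym[OF assms(1)] adj_or_eq_sym[OF assms(2)]
  by (auto simp: digital_image_def image_prod_def)

text \<open>Symmetry of \<open>adj X\<close> is only known between points of \<open>X\<close>, so
  the proof first records that a path takes its values in \<open>X\<close> on the whole
  interval.\<close>

lemma digital_image_path_space:
  assumes "digital_image X"
  shows "digital_image (path_space m X)"
proof -
  have "\<alpha> t \<in> points X" if "\<alpha> \<in> points (path_space m X)" "t \<in> points (interval m)" for \<alpha> t
    using that by (auto simp: path_space_def digitally_continuous_def)
  then show ?thesis
    unfolding digital_image_def
    using adj_or_eq_sym[OF assms] by (simp add: path_space_def) metis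
qed

text \<open>Reduces continuity of a path to its forward steps; the backward ones follow by symmetry.
  The contraction and the motion planner are both checked this way.\<close>

lemma digitally_continuous_interval:
  assumes X: "digital_image X"
    and pts: "\<And>t. t \<le> m \<Longrightarrow> \<alpha> t \<in> points X"
    and step: "\<And>t. t < m \<Longrightarrow> adj_or_eq X (\<alpha> t) (\<alpha> (Suc t))"
  shows "digitally_continuous (interval m) X \<alpha>"
proof -
  have "adj_or_eq X (\<alpha> s) (\<alpha> t)" if "s \<le> m" "t \<le> m" "t = s + 1 \<or> s = t + 1" for s t
    using that(3)
  proof
    assume "t = s + 1"
    then show ?thesis using step that by simp
  next
    assume s: "s = t + 1"
    then have "adj_or_eq X (\<alpha> t) (\<alpha> s)" using step that by simp
    then show ?thesis by (rule adj_or_eq_sym[OF X pts[OF that(2)] pts[OF that(1)]])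
  qed
  then show ?thesis
    unfolding digitally_continuous_iff[OF digital_image_interval X]
    using pts by (auto simp: interval_def)
qed

text \<open>A clique that is also a dominating set in the sense of graph theory. The notion passes
  to products and quotients, so it only has to be verified on a single sphere.\<close>

definition dominating_clique :: "'a dimage \<Rightarrow> 'a set \<Rightarrow> bool" where
  "dominating_clique X Q \<longleftrightarrow> Q \<subseteq> points X \<and>
     (\<forall>p\<in>Q. \<forall>q\<in>Q. adj_or_eq X p q) \<and> (\<forall>x\<in>points X. \<exists>q\<in>Q. adj_or_eq X x q)"

lemma dominating_clique_choice:
  assumes "dominating_clique X Q"
  obtains f where "\<And>x. x \<in> points X \<Longrightarrow> f x \<in> Q" "\<And>x. x \<in> points X \<Longrightarrow> adj_or_eq X x (f x)"
  using assms unfolding dominating_clique_def by metis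

lemma d_cat_eq_0:
  assumes X: "digital_image X" and ne: "points X \<noteq> {}" and Q: "dominating_clique X Q"
  shows "d_cat X = 0"
proof -
  obtain f where f: "\<And>x. x \<in> points X \<Longrightarrow> f x \<in> Q" "\<And>x. x \<in> points X \<Longrightarrow> adj_or_eq X x (f x)"
    using dominating_clique_choice[OF Q] by blast
  have QX: "Q \<subseteq> points X" and cl: "\<And>p q. p \<in> Q \<Longrightarrow> q \<in> Q \<Longrightarrow> adj_or_eq X p q"
    using Q by (auto simp: dominating_clique_def)
  \<comment> \<open>A nullhomotopy must end at an actual point, hence the assumption that
    \<open>X\<close> is nonempty.\<close>
  obtain c where c: "c \<in> Q" using ne f(1) by blast
  let ?S = "subimage X (points X)"
  define H where "H x t = [x, f x, c] ! t" for x and t :: nat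
  have S: "points ?S = points X" "adj ?S = adj X" by (simp_all add: subimage_def)
  note cont_iff = digitally_continuous_iff[OF digital_image_subimage[OF X order_refl] X, unfolded S]
  have cont: "digitally_continuous ?S X (\<lambda>x. x)" "digitally_continuous ?S X f"
    "digitally_continuous ?S X (\<lambda>_. c)"
    unfolding cont_iff using f(1) QX c cl by (auto simp: adj_or_eq_def)
  have "digitally_continuous (interval 2) X (H x)" if x: "x \<in> points X" for x
    by (rule digitally_continuous_interval[OF X])
       (use x f QX c cl in \<open>auto simp: H_def less_Suc_eq le_Suc_eq numeral_2_eq_2\<close>)
  \<comment> \<open>The slices at times 0, 1, 2 are the identity, \<open>f\<close> and the constant
    \<open>c\<close>, which are the three maps in \<open>cont\<close>.\<close>
  moreover have "digitally_continuous ?S X (\<lambda>x. H x t)" if "t \<in> points (interval 2)" for t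
    using that cont by (auto simp: H_def interval_def le_Suc_eq numeral_2_eq_2)
  ultimately have "digitally_homotopic ?S X (\<lambda>x. x) (\<lambda>_. c)"
    unfolding digitally_homotopic_def S
    by (intro conjI cont exI[of _ "2::nat"] exI[of _ H]) (auto simp: H_def)
  then have "digitally_nullhomotopic ?S X (\<lambda>x. x)"
    using c QX by (auto simp: digitally_nullhomotopic_def)
  then have "d_cat X \<le> enat 0"
    unfolding d_cat_def by (intro Inf_lower) (auto intro!: exI[of _ "\<lambda>_. points X"])
  then show ?thesis by (simp add: zero_enat_def[symmetric])
qed

lemma d_TC_eq_0:
  assumes X: "digital_image X" and Q: "dominating_clique X Q"
  shows "d_TC X = 0"
proof -
  obtain f where f: "\<And>x. x \<in> points X \<Longrightarrow> f x \<in> Q" "\<And>x. x \<in> points X \<Longrightarrow> adj_or_eq X x (f x)"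
    using dominating_clique_choice[OF Q] by blast
  have QX: "Q \<subseteq> points X" and cl: "\<And>p q. p \<in> Q \<Longrightarrow> q \<in> Q \<Longrightarrow> adj_or_eq X p q"
    using Q by (auto simp: dominating_clique_def)
  let ?XX = "image_prod X X"
  let ?S = "subimage ?XX (points ?XX)"
  \<comment> \<open>The middle step stays inside the clique \<open>Q\<close>. The restriction to
    \<open>{0..3}\<close> is there because points of \<open>path_space\<close> are
    extensional.\<close>
  define s where "s p = (\<lambda>t\<in>{0..3}. [fst p, f (fst p), f (snd p), snd p] ! t)" for p
  have S: "points ?S = points X \<times> points X"
    "adj ?S = (\<lambda>p q. p \<noteq> q \<and> adj_or_eq X (fst p) (fst q) \<and> adj_or_eq X (snd p) (snd q))"
    by (simp_all add: subimage_def image_prod_def)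
  have pt: "s p \<in> points (path_space 3 X)" if p: "p \<in> points X \<times> points X" for p
  proof -
    have fX: "f x \<in> points X" if "x \<in> points X" for x using that f(1) QX by blast
    have "digitally_continuous (interval 3) X (s p)"
      by (rule digitally_continuous_interval[OF X])
         (use p f fX adj_or_eq_sym[OF X] cl in
           \<open>auto simp: s_def less_Suc_eq le_Suc_eq numeral_3_eq_3\<close>)
    then show ?thesis
      by (simp add: path_space_def s_def interval_def)
  qed
  have "adj_or_eq (path_space 3 X) (s p) (s q)"
    if "p \<in> points X \<times> points X" "q \<in> points X \<times> points X" "adj ?S p q" for p q
  proof -
    \<comment> \<open>At times 0 and 3 this is the adjacency of \<open>p\<close> and
      \<open>q\<close> in each coordinate; at times 1 and 2 both values lie in
      \<open>Q\<close>.\<close>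
    have "adj_or_eq X (s p t) (s q t)" if "t \<in> points (interval 3)" for t
      using that \<open>p \<in> _\<close> \<open>q \<in> _\<close> \<open>adj ?S p q\<close>[unfolded S] f(1) cl
      by (auto simp: s_def interval_def le_Suc_eq numeral_3_eq_3)
    then show ?thesis
      unfolding adj_or_eq_def[of "path_space 3 X"] by (simp add: path_space_def)
  qed
  then have "digitally_continuous ?S (path_space 3 X) s"
    unfolding digitally_continuous_iff[OF
        digital_image_subimage[OF digital_image_image_prod[OF X X] order_refl]
        digital_image_path_space[OF X]] S(1)
    using pt by blast
  moreover have "path_ends 3 (s p) = p" for p
    by (simp add: path_ends_def s_def)
  ultimately have "\<exists>m s. digitally_continuous ?S (path_space m X) s \<and>
      (\<forall>p\<in>points ?XX. path_ends m (s p) = p)"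
    by blast
  then have "d_TC X \<le> enat 0"
    unfolding d_TC_def by (intro Inf_lower) (auto intro!: exI[of _ "\<lambda>_. points ?XX"])
  then show ?thesis by (simp add: zero_enat_def[symmetric])
qed

lemma basis_vec_S_min: "i \<le> n \<Longrightarrow> basis_vec (n + 1) i \<in> points (S_min n)"
  by (auto simp: S_min_def subimage_def)

lemma adj_or_eq_basis_vec:
  assumes "i \<le> n" "j \<le> n"
  shows "adj_or_eq (S_min n) (basis_vec (n + 1) i) (basis_vec (n + 1) j)"
proof -
  \<comment> \<open>The left side is 1, the right side is -1 or 0.\<close>
  have "basis_vec (n + 1) j j \<noteq> neg_vec (n + 1) (basis_vec (n + 1) i) j"
    using assms by (simp add: basis_vec_def neg_vec_def)
  then show ?thesis
    unfolding adj_or_eq_def using adj_S_min basis_vec_S_min assms by metis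
qed

lemma S_min_adj_basis_vec:
  assumes "n \<ge> 1" "x \<in> points (S_min n)"
  shows "\<exists>i\<le>n. adj (S_min n) x (basis_vec (n + 1) i)"
proof -
  obtain j where "x = basis_vec (n + 1) j \<or> x = neg_vec (n + 1) (basis_vec (n + 1) j)"
    using assms(2) by (auto simp: S_min_def subimage_def)
  \<comment> \<open>A second axis exists because \<open>n\<close> is at least 1. On it
    \<open>x\<close> vanishes, so its basis vector, with entry 1 there, is neither \<open>x\<close>
    nor the antipode of \<open>x\<close>.\<close>
  moreover obtain i where "i \<le> n" "i \<noteq> j" using assms(1) by (cases "j = 0") auto
  ultimately have "x i \<noteq> basis_vec (n + 1) i i" "basis_vec (n + 1) i i \<noteq> neg_vec (n + 1) x i"
    by (auto simp: basis_vec_def neg_vec_def)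
  then have "adj (S_min n) x (basis_vec (n + 1) i)"
    using adj_S_min[OF assms(2) basis_vec_S_min[OF \<open>i \<le> n\<close>]] by metis
  then show ?thesis using \<open>i \<le> n\<close> by blast
qed

lemma dominating_clique_quotient:
  assumes R: "equiv (points X) R" and Q: "dominating_clique X Q"
  shows "dominating_clique (image_quotient X R) ((\<lambda>q. R `` {q}) ` Q)"
proof -
  have QX: "Q \<subseteq> points X" using Q by (simp add: dominating_clique_def)
  \<comment> \<open>One adjacent pair of representatives suffices in a quotient, so the projection
    carries both the clique and its domination over to the classes.\<close>
  have adj: "adj_or_eq (image_quotient X R) (R `` {x}) (R `` {y})"
    if "x \<in> points X" "y \<in> points X" "adj_or_eq X x y" for x y
    using that equiv_class_self[OF R] by (auto simp: adj_or_eq_def image_quotient_def)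
  show ?thesis
    unfolding dominating_clique_def
  proof (intro conjI ballI)
    show "(\<lambda>q. R `` {q}) ` Q \<subseteq> points (image_quotient X R)"
      using QX by (auto simp: image_quotient_def intro: quotientI)
  next
    fix A B assume "A \<in> (\<lambda>q. R `` {q}) ` Q" "B \<in> (\<lambda>q. R `` {q}) ` Q"
    then show "adj_or_eq (image_quotient X R) A B"
      using adj QX Q unfolding dominating_clique_def by blast
  next
    fix A assume "A \<in> points (image_quotient X R)"
    then obtain x where x: "x \<in> points X" "A = R `` {x}"
      by (auto simp: image_quotient_def elim: quotientE)
    then obtain q where "q \<in> Q" "adj_or_eq X x q"
      using Q by (auto simp: dominating_clique_def)
    then show "\<exists>B\<in>(\<lambda>q. R `` {q}) ` Q. adj_or_eq (image_quotient X R) A B"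
      using adj x QX by blast
  qed
qed

lemma adj_or_eq_Prod:
  "\<forall>i\<in>I. adj_or_eq (X i) (x i) (y i) \<Longrightarrow> adj_or_eq (image_Prod I X) x y"
  unfolding adj_or_eq_def[of "image_Prod I X"] by (simp add: image_Prod_def)

lemma dominating_clique_Prod:
  assumes "\<And>i. i \<in> I \<Longrightarrow> dominating_clique (X i) (Q i)"
  shows "dominating_clique (image_Prod I X) (\<Pi>\<^sub>E i\<in>I. Q i)"
  unfolding dominating_clique_def
proof (intro conjI ballI)
  show "(\<Pi>\<^sub>E i\<in>I. Q i) \<subseteq> points (image_Prod I X)"
    using assms by (fastforce simp: image_Prod_def dominating_clique_def PiE_iff)
next
  fix p q assume "p \<in> (\<Pi>\<^sub>E i\<in>I. Q i)" "q \<in> (\<Pi>\<^sub>E i\<in>I. Q i)"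
  then have "\<forall>i\<in>I. adj_or_eq (X i) (p i) (q i)"
    using assms by (auto simp: dominating_clique_def PiE_iff)
  then show "adj_or_eq (image_Prod I X) p q"
    by (rule adj_or_eq_Prod)
next
  fix x assume "x \<in> points (image_Prod I X)"
  then have "\<forall>i\<in>I. \<exists>q\<in>Q i. adj_or_eq (X i) (x i) q"
    using assms by (auto simp: image_Prod_def dominating_clique_def PiE_iff)
  then obtain q where "\<forall>i\<in>I. q i \<in> Q i \<and> adj_or_eq (X i) (x i) (q i)"
    by metis
  \<comment> \<open>The chosen \<open>q\<close> is arbitrary outside \<open>I\<close>; restricting
    it makes it a member of the extensional product.\<close>
  then have "restrict q I \<in> (\<Pi>\<^sub>E i\<in>I. Q i)" "adj_or_eq (image_Prod I X) x (restrict q I)"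
    by (auto intro: adj_or_eq_Prod)
  then show "\<exists>q\<in>\<Pi>\<^sub>E i\<in>I. Q i. adj_or_eq (image_Prod I X) x q" by blast
qed

text \<open>The positive basis vectors contain one point of each antipodal pair, so no two of them
  are antipodal.\<close>

lemma dominating_clique_S_min:
  assumes "n \<ge> 1"
  shows "dominating_clique (S_min n) (basis_vec (n + 1) ` {0..n})"
  unfolding dominating_clique_def
proof (intro conjI ballI)
  show "basis_vec (n + 1) ` {0..n} \<subseteq> points (S_min n)"
    using basis_vec_S_min by auto
next
  fix p q
  assume "p \<in> basis_vec (n + 1) ` {0..n}" "q \<in> basis_vec (n + 1) ` {0..n}"
  then show "adj_or_eq (S_min n) p q"
    using adj_or_eq_basis_vec by auto
next
  fix x assume "x \<in> points (S_min n)"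
  then obtain i where "i \<le> n" "adj (S_min n) x (basis_vec (n + 1) i)"
    using S_min_adj_basis_vec[OF assms] by blast
  then show "\<exists>q\<in>basis_vec (n + 1) ` {0..n}. adj_or_eq (S_min n) x q"
    by (intro bexI[of _ "basis_vec (n + 1) i"]) (auto simp: adj_or_eq_def)
qed

theorem corollary3p4:
  fixes r :: nat and n :: "nat \<Rightarrow> nat"
  assumes "r \<ge> 1"
    and "\<forall>k\<in>{1..r}. n k \<ge> 1"
    and "mono_on {1..r} n"
  shows "d_TC (d_P r n) \<le> 2 * d_cat (d_P r n) \<and>
         2 * d_cat (d_P r n) \<le> 2 * enat (n 1 + r - 1)"
proof -
  let ?Q = "\<Pi>\<^sub>E k\<in>{1..r}. basis_vec (n k + 1) ` {0..n k}"
  have "dominating_clique (sphere_prod r n) ?Q"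
    unfolding sphere_prod_def
    by (intro dominating_clique_Prod dominating_clique_S_min) (use assms(2) in blast)
  then have Q: "dominating_clique (d_P r n) ((\<lambda>q. antipodal_rel r n `` {q}) ` ?Q)"
    unfolding d_P_def by (rule dominating_clique_quotient[OF equiv_antipodal_rel])
  have "?Q \<noteq> {}" by (auto simp: PiE_eq_empty_iff)
  then have "points (d_P r n) \<noteq> {}"
    using Q unfolding dominating_clique_def by blast
  then have "d_cat (d_P r n) = 0"
    using d_cat_eq_0 digital_image_d_P Q by blast
  moreover have "d_TC (d_P r n) = 0"
    using d_TC_eq_0 digital_image_d_P Q by blast
  \<comment> \<open>With both invariants zero, the claim reads 0 \<le> 2 * 0 together with 2 * 0
    \<le> \<open>2 * enat (n 1 + r - 1)\<close>.\<close>
  ultimately show ?thesis by simp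
qed

end
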